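(* Let $\mathcal{Q}$ be a hyperbolic polar space of rank $r$ over $\mathbb{F}_q$ (type $\Omega^+(q)$), and let $D$ be a $t$-$(r,r,1)_{\Omega^+(q)}$ Steiner system in $\mathcal{Q}$ of strength $t\ge 2$. Then $D$ is either the complete design (the set of all generators of $\mathcal{Q}$) or a Latin-Greek design (one of the two classes, Latins or Greeks, of generators of $\mathcal{Q}$).
   Context: Let $q$ be a prime power. The hyperbolic polar space $\mathcal{Q}=\Omega^+(2r,q)$ of rank $r$ consists of all totally singular subspaces of a $2r$-dimensional $\mathbb{F}_q$-vector space $V$ equipped with a non-singular quadratic form of hyperbolic type (Witt index $r$). All dimensions are vector space dimensions. The $r$-dimensional subspaces of $\mathcal{Q}$ are called generators. For $t,k\in\{0,\ldots,r\}$ and an integer $\lambda\ge 0$, a $t$-$(r,k,\lambda)_{\Omega^+(q)}$ design in $\mathcal{Q}$ is a set $D$ of $k$-dimensional subspaces of $\mathcal{Q}$ (called blocks) such that every $t$-dimensional subspace of $\mathcal{Q}$ is contained in exactly $\lambda$ elements of $D$; $t$ is called its strength. A Steiner system is a design with $\lambda=1$. The complete design (for given $k$) is the set of all $k$-dimensional subspaces of $\mathcal{Q}$. Latin-Greek designs: on the set of generators of $\mathcal{Q}$, the relation "$r-\dim(B\cap B')$ is even" is an equivalence relation with exactly two classes, called the Latins and the Greeks. Each of the two classes is an $(r-1)$-$(r,r,1)_{\Omega^+(q)}$ design; each of them is called a Latin-Greek design (or Latin-Greek halving). *)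

theory Defs
  imports Complex_Main
begin

locale quadratic_space = vector_space scale
  for scale :: "'a::field \<Rightarrow> 'b::ab_group_add \<Rightarrow> 'b" (infixr "*s" 75) +
  fixes Q :: "'b \<Rightarrow> 'a"
begin

definition polar_form :: "'b \<Rightarrow> 'b \<Rightarrow> 'a" where
  "polar_form u v = Q (u + v) - Q u - Q v"

definition quadratic_form :: bool where
  "quadratic_form \<longleftrightarrow>
     (\<forall>a v. Q (a *s v) = a\<^sup>2 * Q v) \<and>
     (\<forall>u. Vector_Spaces.linear scale (*) (\<lambda>v. polar_form u v)) \<and>
     (\<forall>v. Vector_Spaces.linear scale (*) (\<lambda>u. polar_form u v))"

text \<open>In characteristic 2 this is weaker than non-degeneracy of the polar form.\<close>

definition nonsingular_form :: bool where
  "nonsingular_form \<longleftrightarrow> (\<forall>v. Q v = 0 \<and> (\<forall>u. polar_form u v = 0) \<longrightarrow> v = 0)"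

definition totally_singular :: "'b set \<Rightarrow> bool" where
  "totally_singular U \<longleftrightarrow> subspace U \<and> (\<forall>u\<in>U. Q u = 0)"

definition witt_index :: nat where
  "witt_index = Max {dim U | U. totally_singular U}"

end

text \<open>The order of the ground field is the cardinality of the type \<^typ>\<open>'a\<close>.
  The assumption \<open>finite_dim\<close> is needed only for \<open>r = 0\<close>, since \<open>dim\<close> is 0 on
  infinite-dimensional spaces.\<close>

locale hyperbolic_polar_space = quadratic_space scale Q
  for scale :: "'a::{field,finite} \<Rightarrow> 'b::ab_group_add \<Rightarrow> 'b" (infixr "*s" 75)
    and Q :: "'b \<Rightarrow> 'a" +
  fixes r :: nat
  assumes finite_dim: "\<exists>S. finite S \<and> span S = UNIV"
    and dim_UNIV_eq: "dim (UNIV :: 'b set) = 2 * r"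
    and quadratic: "quadratic_form"
    and nonsingular: "nonsingular_form"
    and witt_index_eq: "witt_index = r"
begin

definition polar_subspaces :: "nat \<Rightarrow> 'b set set" where
  "polar_subspaces k = {U. totally_singular U \<and> dim U = k}"

definition generators :: "'b set set" where
  "generators = polar_subspaces r"

definition design :: "nat \<Rightarrow> nat \<Rightarrow> nat \<Rightarrow> 'b set set \<Rightarrow> bool" where
  "design t k l D \<longleftrightarrow>
     t \<le> r \<and> k \<le> r \<and> D \<subseteq> polar_subspaces k \<and>
     (\<forall>T\<in>polar_subspaces t. card {B \<in> D. T \<subseteq> B} = l)"

definition steiner_system :: "nat \<Rightarrow> nat \<Rightarrow> 'b set set \<Rightarrow> bool" where
  "steiner_system t k D \<longleftrightarrow> design t k 1 D"

definition complete_design :: "nat \<Rightarrow> 'b set set" where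
  "complete_design k = polar_subspaces k"

definition latin_greek_rel :: "('b set \<times> 'b set) set" where
  "latin_greek_rel =
     {(B, B'). B \<in> generators \<and> B' \<in> generators \<and> even (r - dim (B \<inter> B'))}"

text \<open>The two elements of the quotient are the Latins and the Greeks.\<close>

definition latin_greek_design :: "'b set set \<Rightarrow> bool" where
  "latin_greek_design D \<longleftrightarrow> D \<in> generators // latin_greek_rel"

end

end

theory Submission
  imports Defs
begin

text \<open>
  Any three generators satisfy \<open>r + dim (A \<inter> B) + dim (B \<inter> C) + dim (A \<inter> C) \<equiv> 0 (mod 2)\<close>, and an
  \<open>(r - 1)\<close>-space lies in at most two generators. For \<open>t = r - 1\<close> the system contains exactly
  one of any two adjacent generators, so membership is determined by the parity of the distance to a
  fixed block.

  Let \<open>2 \<le> t < r\<close>. Parity forces two distinct blocks through a common \<open>(t - 2)\<close>-space \<open>T0\<close>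
  to meet in dimension exactly \<open>t - 1\<close>. Take a block \<open>B\<close> through \<open>T0\<close> and a singular point
  \<open>p \<notin> B\<close> orthogonal to \<open>T0\<close>, and put \<open>T = T0 + p\<close> and \<open>H = p + (B \<inter> p\<^sup>\<bottom>)\<close>. Every block
  through \<open>T\<close> meets \<open>H\<close> in dimension exactly \<open>t\<close>, hence meets a generator \<open>G \<supseteq> T\<close> adjacent to
  \<open>H\<close> either in \<open>T\<close> or in dimension \<open>t + 1\<close>. These blocks partition \<open>G - T\<close>, and comparing
  their vectors inside and outside \<open>K = G \<inter> H\<close> gives \<open>|G - K| = q |K - T|\<close>, that is
  \<open>q^r - q^(r - 1) = q (q^(r - 1) - q^(t - 1))\<close>, so \<open>t = r - 1\<close>.
\<close>

text \<open>The locale of finite-dimensional spaces takes a basis as a parameter, so one basis is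
  fixed by choice; this makes its dimension theory available.\<close>

definition (in hyperbolic_polar_space) ambient_basis :: "'b set" where
  "ambient_basis = (SOME B. finite B \<and> independent B \<and> span B = UNIV)"

sublocale hyperbolic_polar_space \<subseteq> finite_dimensional_vector_space scale ambient_basis
proof -
  obtain S :: "'b set" where S: "finite S" "span S = UNIV" using finite_dim by blast
  obtain B where B: "B \<subseteq> S" "independent B" "S \<subseteq> span B"
    using maximal_independent_subset[of S] by blast
  have "span B = UNIV"
    using B(3) S(2) by (metis span_mono span_span top.extremum_uniqueI)
  then have "\<exists>B. finite B \<and> independent B \<and> span B = (UNIV :: 'b set)"
    using B(2) finite_subset[OF B(1) S(1)] by auto
  then have "finite ambient_basis \<and> independent ambient_basis \<and> span ambient_basis = (UNIV :: 'b set)"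
    unfolding ambient_basis_def by (rule someI_ex)
  then show "finite_dimensional_vector_space scale ambient_basis"
    by unfold_locales auto
qed

context hyperbolic_polar_space
begin

subsection \<open>Orthogonality\<close>

lemma Q_scale: "Q (a *s v) = a\<^sup>2 * Q v"
  using quadratic by (simp add: quadratic_form_def)

lemma Q_0 [simp]: "Q 0 = 0"
  using Q_scale[of 0 0] by simp

lemma Q_add: "Q (u + v) = Q u + Q v + polar_form u v"
  by (simp add: polar_form_def)

lemma polar_sym: "polar_form u v = polar_form v u"
  by (simp add: polar_form_def add.commute)

lemma polar_add_right: "polar_form u (v + w) = polar_form u v + polar_form u w"
  using quadratic unfolding quadratic_form_def Vector_Spaces.linear_iff by blast

lemma polar_scale_right: "polar_form u (a *s v) = a * polar_form u v"
  using quadratic unfolding quadratic_form_def Vector_Spaces.linear_iff by blast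

lemma polar_0_right [simp]: "polar_form u 0 = 0"
  using polar_scale_right[of u 0 0] by simp

lemma polar_diff_right: "polar_form u (v - w) = polar_form u v - polar_form u w"
  using polar_add_right[of u "v - w" w] by simp

definition perp :: "'b set \<Rightarrow> 'b set" where
  "perp U = {v. \<forall>u\<in>U. polar_form u v = 0}"

lemma subspace_perp [simp]: "subspace (perp U)"
  by (rule subspaceI) (auto simp: perp_def polar_add_right polar_scale_right)

lemma perp_antimono: "U \<subseteq> W \<Longrightarrow> perp W \<subseteq> perp U"
  by (auto simp: perp_def)

lemma subset_perp_iff: "U \<subseteq> perp W \<longleftrightarrow> W \<subseteq> perp U"
  unfolding perp_def subset_iff mem_Collect_eq by (metis polar_sym)

lemma perp_span [simp]: "perp (span S) = perp S"
proof
  have "span S \<subseteq> perp (perp S)"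
    by (rule span_minimal) (simp_all add: subset_perp_iff[of S])
  then show "perp S \<subseteq> perp (span S)" by (simp add: subset_perp_iff)
qed (simp add: perp_antimono span_superset)

section \<open>Dimension formulas and the number of vectors of a subspace\<close>

lemma span_insert_subspace:
  assumes "subspace U"
  shows "y \<in> span (insert x U) \<longleftrightarrow> (\<exists>k. y - k *s x \<in> U)"
  by (simp add: span_breakdown_eq span_eq_iff[THEN iffD2, OF assms])

lemma dim_insert_subspace:
  assumes "subspace U" "x \<notin> U"
  shows "dim (insert x U) = Suc (dim U)"
  using assms(2) by (simp add: dim_insert span_eq_iff[THEN iffD2, OF assms(1)])

lemma span_insert_le:
  assumes "subspace W" "U \<subseteq> W" "x \<in> W"
  shows "span (insert x U) \<subseteq> W"
  using assms by (simp add: span_minimal)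

text \<open>\<open>perp {u}\<close> is the kernel of a linear functional; a vector \<open>w\<close>
  on which it does not vanish spans a complement of the kernel in \<open>W\<close>.\<close>

lemma dim_Int_perp_single: "subspace W \<Longrightarrow> dim W \<le> Suc (dim (W \<inter> perp {u}))"
proof (cases "W \<subseteq> perp {u}")
  case True
  then show ?thesis by (simp add: inf_absorb1)
next
  case False
  assume W: "subspace W"
  obtain w where w: "w \<in> W" "polar_form u w \<noteq> 0" using False by (auto simp: perp_def)
  have "W \<subseteq> span (insert w (W \<inter> perp {u}))"
  proof
    fix x assume "x \<in> W"
    then have "x - (polar_form u x / polar_form u w) *s w \<in> W \<inter> perp {u}"
      using w W by (simp add: perp_def polar_diff_right polar_scale_right subspace_diff subspace_scale)
    then show "x \<in> span (insert w (W \<inter> perp {u}))"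
      using W by (subst span_insert_subspace) (auto simp: subspace_inter)
  qed
  then have "dim W \<le> dim (insert w (W \<inter> perp {u}))" by (rule dim_mono)
  then show ?thesis by (simp add: dim_insert split: if_splits)
qed

lemma dim_Int_perp_finite:
  assumes "finite S" "subspace W"
  shows "dim W \<le> card S + dim (W \<inter> perp S)"
  using assms(1)
proof induction
  case empty
  then show ?case by (simp add: perp_def)
next
  case (insert x S)
  have "dim (W \<inter> perp S) \<le> Suc (dim (W \<inter> perp S \<inter> perp {x}))"
    by (intro dim_Int_perp_single subspace_inter assms subspace_perp)
  moreover have "W \<inter> perp S \<inter> perp {x} = W \<inter> perp (insert x S)"
    by (auto simp: perp_def)
  ultimately show ?case using insert by simp
qed

text \<open>Extend a basis \<open>B0\<close> of \<open>U \<inter> perp W\<close> to a basis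
  \<open>B\<close> of \<open>U\<close>. The vectors of \<open>B0\<close> impose no condition on
  \<open>W\<close>, so \<open>W \<inter> perp U\<close> is cut out of \<open>W\<close> by the
  remaining basis vectors alone.\<close>

lemma dim_Int_perp_le:
  assumes "subspace U" "subspace W"
  shows "dim W + dim (U \<inter> perp W) \<le> dim U + dim (W \<inter> perp U)"
proof -
  have U0: "subspace (U \<inter> perp W)" using assms by (simp add: subspace_inter)
  obtain B0 where B0: "B0 \<subseteq> U \<inter> perp W" "independent B0" "span B0 = U \<inter> perp W"
      "card B0 = dim (U \<inter> perp W)"
    using basis_subspace_exists[OF U0] by metis
  obtain B where B: "B0 \<subseteq> B" "B \<subseteq> U" "independent B" "U \<subseteq> span B"
    using maximal_independent_subset_extend[of B0 U] B0 by auto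
  have fB: "finite B" using B(3) by (rule finiteI_independent)
  have cB: "card B = dim U" using basis_card_eq_dim[OF B(2,4,3)] .
  have sB: "span B = U" using B assms(1) by (simp add: span_subspace)
  have "W \<subseteq> perp B0" using B0(1) by (simp add: subset_perp_iff)
  moreover have "perp U = perp B" using sB perp_span by metis
  ultimately have "W \<inter> perp U = W \<inter> perp (B - B0)"
    using B(1) by (auto simp: perp_def subset_iff)
  moreover have "dim W \<le> card (B - B0) + dim (W \<inter> perp (B - B0))"
    using fB assms(2) by (simp add: dim_Int_perp_finite)
  moreover have "card (B - B0) + card B0 = card B"
    using B(1) fB by (metis card_Diff_subset card_mono finite_subset le_add_diff_inverse2)
  ultimately show ?thesis using cB B0(4) by simp
qed

text \<open>The polar form pairs \<open>U\<close> modulo \<open>U \<inter> perp W\<close> perfectly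
  with \<open>W\<close> modulo \<open>W \<inter> perp U\<close>; the inequality is used in both
  directions.\<close>

lemma dim_Int_perp:
  assumes "subspace U" "subspace W"
  shows "dim W + dim (U \<inter> perp W) = dim U + dim (W \<inter> perp U)"
  using dim_Int_perp_le[OF assms] dim_Int_perp_le[OF assms(2,1)] by simp

lemma dim_Int_hyperplane:
  assumes "subspace X" "subspace Y" "subspace K" "K \<subseteq> X" "dim X = Suc (dim K)" "Y \<subseteq> X"
  shows "dim Y \<le> Suc (dim (Y \<inter> K))"
proof -
  have "dim {x + y |x y. x \<in> Y \<and> y \<in> K} + dim (Y \<inter> K) = dim Y + dim K"
    using assms by (simp add: dim_sums_Int)
  moreover have "dim {x + y |x y. x \<in> Y \<and> y \<in> K} \<le> dim X"
    by (rule dim_subset) (use assms in \<open>auto intro: subspace_add\<close>)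
  ultimately show ?thesis using assms by simp
qed

lemma subspace_of_dim:
  assumes "subspace W" "n \<le> dim W"
  obtains T where "subspace T" "T \<subseteq> W" "dim T = n"
  using choose_subspace_of_subspace[OF assms(2)] span_eq_iff[THEN iffD2, OF assms(1)] by metis

text \<open>Every further basis vector multiplies the number of vectors by the order of the field,
  since the decomposition \<open>k *s b + u\<close> is unique.\<close>

lemma card_subspace:
  assumes "subspace U"
  shows "finite U" "card U = card (UNIV :: 'a set) ^ dim U"
proof -
  have *: "finite (span B) \<and> card (span B) = card (UNIV :: 'a set) ^ card B" if "finite B" "independent B" for B
    using that
  proof (induction B)
    case empty
    then show ?case by simp
  next
    case (insert b B)
    then have b: "b \<notin> span B" and B: "independent B"
      by (auto simp: independent_insert)
    have inj: "inj_on (\<lambda>(k, u). k *s b + u) (UNIV \<times> span B)"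
    proof (rule inj_onI, clarify)
      fix k u l v assume uv: "u \<in> span B" "v \<in> span B" and eq: "k *s b + u = l *s b + v"
      have "(k - l) *s b = v - u" using eq by (simp add: scale_left_diff_distrib algebra_simps)
      then have "(k - l) *s b \<in> span B" using uv by (simp add: span_diff)
      then have "k = l"
        using b by (metis eq_iff_diff_eq_0 field_class.field_inverse scale_one scale_scale span_scale)
      then show "k = l \<and> u = v" using eq by simp
    qed
    have im: "(\<lambda>(k, u). k *s b + u) ` (UNIV \<times> span B) = span (insert b B)"
    proof (intro equalityI subsetI)
      fix x assume "x \<in> span (insert b B)"
      then obtain k where "x - k *s b \<in> span B" by (auto simp: span_breakdown_eq)
      then show "x \<in> (\<lambda>(k, u). k *s b + u) ` (UNIV \<times> span B)"
        by (intro image_eqI[of _ _ "(k, x - k *s b)"]) auto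
    next
      fix x assume "x \<in> (\<lambda>(k, u). k *s b + u) ` (UNIV \<times> span B)"
      then obtain k u where "u \<in> span B" "x = k *s b + u" by auto
      then show "x \<in> span (insert b B)" unfolding span_breakdown_eq by (intro exI[of _ k]) simp
    qed
    have "finite (span B)" "card (span B) = card (UNIV :: 'a set) ^ card B" using insert.IH B by auto
    then show ?case
      using card_image[OF inj] insert.hyps by (simp add: im[symmetric] card_cartesian_product)
  qed
  obtain B where "finite B" "independent B" "span B = U" "card B = dim U"
    using basis_subspace_exists[OF assms] by metis
  with *[of B] show "finite U" "card U = card (UNIV :: 'a set) ^ dim U" by simp_all
qed

subsection \<open>Totally singular subspaces and generators\<close>

lemma ts_subspace: "totally_singular U \<Longrightarrow> subspace U"
  by (simp add: totally_singular_def)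

lemma ts_Q: "totally_singular U \<Longrightarrow> u \<in> U \<Longrightarrow> Q u = 0"
  by (simp add: totally_singular_def)

lemma ts_mono: "totally_singular W \<Longrightarrow> subspace U \<Longrightarrow> U \<subseteq> W \<Longrightarrow> totally_singular U"
  by (auto simp: totally_singular_def)

lemma ts_polar: "totally_singular U \<Longrightarrow> u \<in> U \<Longrightarrow> v \<in> U \<Longrightarrow> polar_form u v = 0"
  by (auto simp: totally_singular_def polar_form_def subspace_add)

lemma ts_subset_perp: "totally_singular U \<Longrightarrow> W \<subseteq> U \<Longrightarrow> U \<subseteq> perp W"
  by (auto simp: perp_def ts_polar)

lemma ts_span_insert:
  assumes "totally_singular U" "Q x = 0" "x \<in> perp U"
  shows "totally_singular (span (insert x U))"
proof -
  have "Q y = 0" if y: "y \<in> span (insert x U)" for y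
  proof -
    obtain k where k: "y - k *s x \<in> U"
      using y assms by (auto simp: span_insert_subspace ts_subspace)
    have "Q ((y - k *s x) + k *s x) = 0"
      using assms k by (subst Q_add) (auto simp: Q_scale ts_Q polar_scale_right perp_def)
    then show ?thesis by simp
  qed
  then show ?thesis by (simp add: totally_singular_def)
qed

text \<open>The \<open>Max\<close> in \<open>witt_index\<close> is meaningful only for a finite
  nonempty set.\<close>

lemma ts_dims: "finite {dim U | U. totally_singular U}" "{dim U | U. totally_singular U} \<noteq> {}"
proof -
  have "{dim U | U. totally_singular U} \<subseteq> {..2 * r}"
    using dim_subset[OF subset_UNIV] dim_UNIV_eq by auto
  then show "finite {dim U | U. totally_singular U}" by (rule finite_subset) simp
  have "totally_singular {0}" by (simp add: totally_singular_def)
  then show "{dim U | U. totally_singular U} \<noteq> {}" by auto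
qed

lemma ts_dim_le: "totally_singular U \<Longrightarrow> dim U \<le> r"
  using Max_ge[OF ts_dims(1)] witt_index_eq unfolding witt_index_def by auto

lemma generator_exists: "\<exists>A. A \<in> generators"
  using Max_in[OF ts_dims] witt_index_eq
  unfolding witt_index_def generators_def polar_subspaces_def by auto

lemma generatorI: "totally_singular A \<Longrightarrow> dim A = r \<Longrightarrow> A \<in> generators"
  by (simp add: generators_def polar_subspaces_def)

lemma generatorD:
  assumes "A \<in> generators"
  shows "totally_singular A" "subspace A" "dim A = r"
  using assms by (auto simp: generators_def polar_subspaces_def totally_singular_def)

lemma generator_ts_mono:
  assumes "A \<in> generators" "subspace U" "U \<subseteq> A"
  shows "totally_singular U"
  using ts_mono[OF generatorD(1)[OF assms(1)] assms(2,3)] .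

lemma generator_subset_perp:
  assumes "A \<in> generators" "U \<subseteq> A"
  shows "A \<subseteq> perp U"
  using ts_subset_perp[OF generatorD(1)[OF assms(1)] assms(2)] .

lemma generator_eq: "A \<in> generators \<Longrightarrow> B \<in> generators \<Longrightarrow> A \<subseteq> B \<Longrightarrow> A = B"
  by (simp add: generatorD subspace_dim_equal)

lemma generator_dim_Int_le: "A \<in> generators \<Longrightarrow> dim (A \<inter> B) \<le> r"
  using dim_subset[of "A \<inter> B" A] generatorD by auto

lemma generator_dim_Int_eq:
  assumes "A \<in> generators" "B \<in> generators" "dim (A \<inter> B) = r"
  shows "A = B"
proof -
  have "A \<inter> B = A" using assms by (intro subspace_dim_equal) (auto simp: generatorD subspace_inter)
  then show ?thesis using generator_eq assms by blast
qed

text \<open>Nonsingularity keeps nonzero singular vectors out of the radical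
  \<open>perp UNIV\<close>. As \<open>U\<close> is totally singular, it meets the radical trivially,
  and duality with the whole space gives the formula.\<close>

lemma dim_perp_ts:
  assumes "totally_singular U"
  shows "dim U + dim (perp U) = 2 * r"
proof -
  have "U \<inter> perp UNIV \<subseteq> {0}"
    using nonsingular assms by (auto simp: nonsingular_form_def perp_def ts_Q)
  then have "dim (U \<inter> perp UNIV) = 0" by (simp only: dim_eq_0)
  then show ?thesis
    using dim_Int_perp[of U UNIV] dim_UNIV_eq assms by (simp add: ts_subspace del: dim_UNIV dim_eq_0)
qed

text \<open>This is where the hyperbolic type enters: the dimension \<open>2 * r\<close> is twice
  the Witt index.\<close>

lemma perp_generator:
  assumes "A \<in> generators"
  shows "perp A = A"
proof (rule subspace_dim_equal[symmetric])
  note A = generatorD[OF assms]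
  show "subspace A" "A \<subseteq> perp A" using A ts_subset_perp by auto
  show "dim (perp A) \<le> dim A" using dim_perp_ts[OF A(1)] A(3) by linarith
qed simp

text \<open>\<open>perp T\<close> has dimension above \<open>r\<close>, so it contains some
  \<open>v\<close> outside \<open>A\<close>. A multiple of a vector of \<open>A\<close> not
  orthogonal to \<open>v\<close> then corrects \<open>v\<close> to a singular vector.\<close>

lemma singular_outside:
  assumes "A \<in> generators" "subspace T" "T \<subseteq> A" "dim T < r"
  obtains x where "x \<in> perp T" "Q x = 0" "x \<notin> A"
proof -
  have T: "totally_singular T" using assms(1-3) by (rule generator_ts_mono)
  obtain v where v: "v \<in> perp T" "v \<notin> A"
  proof -
    have "\<not> perp T \<subseteq> A"
      using dim_perp_ts[OF T] assms(4) dim_subset[of "perp T" A] generatorD(3)[OF assms(1)] by linarith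
    then show ?thesis using that by blast
  qed
  obtain a where a: "a \<in> A" "polar_form a v \<noteq> 0"
    using v perp_generator[OF assms(1)] by (auto simp: perp_def)
  \<comment> \<open>The root of \<open>Q v + k * polar_form a v\<close>, which is linear in
    \<open>k\<close> because \<open>a\<close> is singular.\<close>
  define k where "k = - Q v / polar_form a v"
  have "Q a = 0" using ts_Q[OF generatorD(1)[OF assms(1)] a(1)] .
  then have "Q (v + k *s a) = Q v + k * polar_form a v"
    by (simp only: Q_add Q_scale polar_scale_right polar_sym[of v a]) simp
  then have "Q (v + k *s a) = 0" using a(2) by (simp add: k_def)
  moreover have ka: "k *s a \<in> A" using generatorD(2)[OF assms(1)] a(1) by (rule subspace_scale)
  moreover have "v + k *s a \<notin> A"
    using v(2) subspace_diff[OF generatorD(2)[OF assms(1)] _ ka, of "v + k *s a"] by auto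
  moreover have "v + k *s a \<in> perp T"
    using v(1) ka generator_subset_perp[OF assms(1,3)] by (intro subspace_add subspace_perp) auto
  ultimately show ?thesis using that by blast
qed

section \<open>Adjacent generators and the parity law\<close>

definition neighbour :: "'b set \<Rightarrow> 'b \<Rightarrow> 'b set" where
  "neighbour A x = span (insert x (A \<inter> perp {x}))"

text \<open>\<open>A \<inter> perp {x}\<close> has dimension at least \<open>r - 1\<close>. Adding
  \<open>x\<close> keeps it totally singular, and the Witt index then forces dimension exactly
  \<open>r - 1\<close>.\<close>

lemma neighbour:
  assumes "A \<in> generators" "x \<notin> A" "Q x = 0"
  shows "neighbour A x \<in> generators" "A \<inter> neighbour A x = A \<inter> perp {x}"
    "Suc (dim (A \<inter> neighbour A x)) = r" "x \<in> neighbour A x"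
    "\<And>S. S \<subseteq> A \<Longrightarrow> x \<in> perp S \<Longrightarrow> S \<subseteq> neighbour A x"
proof -
  let ?K = "A \<inter> perp {x}"
  have K: "subspace ?K" "x \<notin> ?K" using assms by (auto simp: generatorD subspace_inter)
  have tK: "totally_singular ?K" using assms(1) K(1) by (rule generator_ts_mono) simp
  have ts: "totally_singular (neighbour A x)"
    unfolding neighbour_def
    by (rule ts_span_insert) (use tK assms in \<open>auto simp: perp_def polar_sym\<close>)
  have d: "dim (neighbour A x) = Suc (dim ?K)"
    using K by (simp add: neighbour_def dim_insert_subspace)
  have "r \<le> Suc (dim ?K)" using dim_Int_perp_single[of A x] assms by (simp add: generatorD)
  then have r: "r = Suc (dim ?K)" using d ts_dim_le[OF ts] by simp
  then show "neighbour A x \<in> generators"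
    using generatorI[OF ts] d by metis
  show x: "x \<in> neighbour A x" by (simp add: neighbour_def span_base)
  have "?K \<subseteq> neighbour A x" by (auto simp: neighbour_def span_base)
  moreover have "neighbour A x \<subseteq> perp {x}" using ts_subset_perp[OF ts] x by simp
  ultimately show *: "A \<inter> neighbour A x = ?K" by auto
  show "Suc (dim (A \<inter> neighbour A x)) = r" using r * by simp
  show "S \<subseteq> neighbour A x" if "S \<subseteq> A" "x \<in> perp S" for S
    using that subset_perp_iff[of "{x}" S] * by auto
qed

text \<open>With \<open>K = A \<inter> B\<close>, the quotient of \<open>perp K\<close> by
  \<open>K\<close> is a hyperbolic plane, whose only singular points are those of \<open>A\<close>
  and \<open>B\<close>.\<close>

lemma generators_through_hyperplane:
  assumes A: "A \<in> generators" and B: "B \<in> generators" and G: "G \<in> generators"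
    and AB: "Suc (dim (A \<inter> B)) = r" and sub: "A \<inter> B \<subseteq> G"
  shows "G = A \<or> G = B"
proof (rule ccontr)
  let ?K = "A \<inter> B"
  assume neq: "\<not> (G = A \<or> G = B)"
  have K: "subspace ?K" using A B by (simp add: generatorD subspace_inter)
  have tK: "totally_singular ?K" using A K by (rule generator_ts_mono) simp
  have span_eq: "X = span (insert x ?K)" if "X \<in> generators" "?K \<subseteq> X" "x \<in> X" "x \<notin> ?K" for X x
  proof (rule subspace_dim_equal[symmetric])
    show "span (insert x ?K) \<subseteq> X" using that by (intro span_insert_le) (auto simp: generatorD)
    show "dim X \<le> dim (span (insert x ?K))"
      using that(1,4) AB dim_insert_subspace[OF K] by (simp add: generatorD)
  qed (use that in \<open>auto simp: generatorD\<close>)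
  obtain b where b: "b \<in> B" "b \<notin> A"
    proof -
    have "A \<noteq> B" using AB generatorD(3)[OF A] by auto
    then show ?thesis using that generator_eq[OF B A] by blast
  qed
  obtain g where g: "g \<in> G" "g \<notin> A" using neq generator_eq[of G A] A G by blast
  \<comment> \<open>Both sides have dimension \<open>r + 1\<close>, so a vector \<open>g\<close> of
    \<open>G\<close> outside \<open>A\<close> is a vector of \<open>A\<close> plus a nonzero
    multiple of \<open>b\<close>.\<close>
  have "span (insert b A) = perp ?K"
  proof (rule subspace_dim_equal)
    show "span (insert b A) \<subseteq> perp ?K"
      using generator_subset_perp[of A ?K] generator_subset_perp[of B ?K] A B b
      by (intro span_insert_le) auto
    show "dim (perp ?K) \<le> dim (span (insert b A))"
      using dim_perp_ts[OF tK] AB A b by (simp add: dim_insert_subspace generatorD)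
  qed auto
  moreover have "g \<in> perp ?K" using generator_subset_perp[of G ?K] G sub g by blast
  ultimately have "g \<in> span (insert b A)" by simp
  then obtain c where c: "g - c *s b \<in> A" (is "?a \<in> A")
    using span_insert_subspace[OF generatorD(2)[OF A]] by blast
  have "c \<noteq> 0" using c g by auto
  have "Q (?a + c *s b) = 0" using g ts_Q[OF generatorD(1)[OF G]] by simp
  moreover have "Q ?a = 0" "Q b = 0"
    using c b ts_Q[OF generatorD(1)[OF A]] ts_Q[OF generatorD(1)[OF B]] by auto
  ultimately have "c * polar_form ?a b = 0"
    by (simp only: Q_add Q_scale polar_scale_right) simp
  then have ab: "polar_form ?a b = 0" using \<open>c \<noteq> 0\<close> by simp
  show False
  proof (cases "?a \<in> ?K")
    case True
    then have "?a + c *s b \<in> B" using b(1) generatorD(2)[OF B] by (blast intro: subspace_add subspace_scale)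
    then have "g \<in> B" by simp
    then have "G = B" using span_eq[of G g] span_eq[of B g] G B g sub by blast
    then show False using neq by blast
  next
    case False
    \<comment> \<open>Here \<open>b\<close> would be orthogonal to all of \<open>A\<close>, hence
      lie in \<open>perp A = A\<close>.\<close>
    then have "A = span (insert ?a ?K)" using span_eq[of A ?a] A c by blast
    then have "perp A = perp (insert ?a ?K)" by (metis perp_span)
    moreover have "b \<in> perp (insert ?a ?K)"
      using ab b ts_polar[OF generatorD(1)[OF B]] by (auto simp: perp_def)
    ultimately show False using perp_generator[OF A] b by blast
  qed
qed

text \<open>By duality \<open>L = C \<inter> perp K\<close> is one dimension larger than
  \<open>K \<inter> C\<close>, where \<open>K = A \<inter> B\<close>. The sum \<open>L + K\<close>
  is a generator through \<open>K\<close>, hence equals \<open>A\<close> or \<open>B\<close>, and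
  that one meets \<open>C\<close> in \<open>L\<close>, the other in
  \<open>K \<inter> C\<close>.\<close>

lemma adjacent_dim_Int:
  assumes A: "A \<in> generators" and B: "B \<in> generators" and C: "C \<in> generators"
    and AB: "Suc (dim (A \<inter> B)) = r"
  shows "dim (A \<inter> C) = Suc (dim (B \<inter> C)) \<or> dim (B \<inter> C) = Suc (dim (A \<inter> C))"
proof -
  let ?K = "A \<inter> B" and ?L = "C \<inter> perp (A \<inter> B)"
  have K: "subspace ?K" using A B by (simp add: generatorD subspace_inter)
  have tK: "totally_singular ?K" using A K by (rule generator_ts_mono) simp
  have L: "subspace ?L" using C by (simp add: generatorD subspace_inter)
  have dL: "dim ?L = Suc (dim (?K \<inter> C))"
    using dim_Int_perp[of ?K C] K C AB by (simp add: generatorD perp_generator)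
  let ?G = "{x + y |x y. x \<in> ?L \<and> y \<in> ?K}"
  have "Q (x + y) = 0" if "x \<in> ?L" "y \<in> ?K" for x y
    using that ts_Q[OF generatorD(1)[OF A]] ts_Q[OF generatorD(1)[OF C]]
    by (auto simp: Q_add perp_def polar_sym[of x])
  then have ts: "totally_singular ?G"
    using subspace_sums[OF L K] by (auto simp: totally_singular_def)
  have "?L \<inter> ?K = ?K \<inter> C" using ts_subset_perp[OF tK order_refl] by auto
  then have "dim ?G = r"
    using dim_sums_Int[OF L K] dL AB by simp
  then have G: "?G \<in> generators" by (rule generatorI[OF ts])
  have LG: "?L \<subseteq> ?G" using subspace_0[OF K] by force
  have KG: "?K \<subseteq> ?G" using subspace_0[OF L] by force
  have main: "dim (X \<inter> C) = Suc (dim (Y \<inter> C))"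
    if "X \<in> generators" "Y \<in> generators" "X \<inter> Y = ?K" "?L \<subseteq> X" for X Y
  proof -
    have "X \<subseteq> perp ?K" using generator_subset_perp[of X ?K] that by blast
    then have "X \<inter> C = ?L" using that by blast
    moreover have "Y \<subseteq> perp ?K" using generator_subset_perp[of Y ?K] that by blast
    then have "Y \<inter> C = ?K \<inter> C" using that by blast
    ultimately show ?thesis using dL by simp
  qed
  have "?G = A \<or> ?G = B" using generators_through_hyperplane[OF A B G AB KG] .
  then show ?thesis
    using main[of A B] main[of B A] A B LG by (auto simp: Int_commute)
qed

text \<open>The neighbour of \<open>A\<close> through a point of \<open>B\<close> outside
  \<open>A\<close> contains this point and all of \<open>A \<inter> B\<close>.\<close>

lemma step_towards:
  assumes A: "A \<in> generators" and B: "B \<in> generators" and "A \<noteq> B"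
  obtains A' where "A' \<in> generators" "Suc (dim (A \<inter> A')) = r" "dim (A' \<inter> B) = Suc (dim (A \<inter> B))"
proof -
  obtain x where x: "x \<in> B" "x \<notin> A" using generator_eq[OF B A] assms(3) by blast
  have qx: "Q x = 0" using ts_Q[OF generatorD(1)[OF B] x(1)] .
  note n = neighbour[OF A x(2) qx]
  have "x \<in> perp (A \<inter> B)" using generator_subset_perp[of B "A \<inter> B"] B x by blast
  then have "A \<inter> B \<subseteq> neighbour A x" by (intro n) auto
  then have "span (insert x (A \<inter> B)) \<subseteq> neighbour A x \<inter> B"
    using x n B by (intro span_insert_le) (auto simp: generatorD subspace_inter)
  then have "Suc (dim (A \<inter> B)) \<le> dim (neighbour A x \<inter> B)"
    using dim_subset[of "span (insert x (A \<inter> B))" "neighbour A x \<inter> B"] x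
      dim_insert_subspace[OF subspace_inter[OF generatorD(2)[OF A] generatorD(2)[OF B]], of x] by simp
  then show ?thesis
    using that[OF n(1,3)] adjacent_dim_Int[OF A n(1) B n(3)] by linarith
qed

text \<open>Moving \<open>A\<close> one step towards \<open>B\<close> raises
  \<open>dim (A \<inter> B)\<close> by one and changes \<open>dim (A \<inter> C)\<close> by one in
  either direction, so the parity of the sum is preserved until \<open>A = B\<close>.\<close>

lemma generator_parity:
  assumes "A \<in> generators" "B \<in> generators" "C \<in> generators"
  shows "even (r + dim (A \<inter> B) + dim (B \<inter> C) + dim (A \<inter> C))"
  using assms
proof (induction "r - dim (A \<inter> B)" arbitrary: A)
  case 0
  then have "A = B" using generator_dim_Int_le[of A B] by (intro generator_dim_Int_eq) auto
  then show ?case using 0 by (simp add: generatorD)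
next
  case (Suc d)
  then have "A \<noteq> B" using generatorD(3)[of B] by auto
  then obtain A' where A': "A' \<in> generators" "Suc (dim (A \<inter> A')) = r"
      "dim (A' \<inter> B) = Suc (dim (A \<inter> B))"
    using step_towards Suc.prems by metis
  have "even (r + dim (A' \<inter> B) + dim (B \<inter> C) + dim (A' \<inter> C))"
    using Suc A' by (intro Suc.hyps) auto
  then show ?case
    using A'(3) adjacent_dim_Int[OF Suc.prems(1) A'(1) Suc.prems(3) A'(2)] by auto
qed

subsection \<open>Steiner systems of generators\<close>

context
  fixes t :: nat and D :: "'b set set"
  assumes steiner: "steiner_system t r D"
begin

lemma block_generator: "B \<in> D \<Longrightarrow> B \<in> generators"
  using steiner by (auto simp: steiner_system_def design_def generators_def)

lemma strength_le: "t \<le> r"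
  using steiner by (simp add: steiner_system_def design_def)

lemma card_blocks_through:
  assumes "totally_singular T" "dim T = t"
  shows "card {B \<in> D. T \<subseteq> B} = 1"
proof -
  have "T \<in> polar_subspaces t" using assms by (simp add: polar_subspaces_def)
  then show ?thesis using steiner unfolding steiner_system_def design_def by blast
qed

lemma block_exists:
  assumes "totally_singular T" "dim T = t"
  obtains B where "B \<in> D" "T \<subseteq> B"
proof -
  have "card {B \<in> D. T \<subseteq> B} = 1" using assms by (rule card_blocks_through)
  then have "{B \<in> D. T \<subseteq> B} \<noteq> {}" by force
  then show ?thesis using that by blast
qed

lemma dim_block_Int_less:
  assumes B: "B \<in> D" and C: "C \<in> D" and neq: "B \<noteq> C"
  shows "dim (B \<inter> C) < t"
proof (rule ccontr)
  assume "\<not> dim (B \<inter> C) < t"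
  then have le: "t \<le> dim (B \<inter> C)" by simp
  note gB = block_generator[OF B] and gC = block_generator[OF C]
  have BC: "subspace (B \<inter> C)" using gB gC by (simp add: generatorD subspace_inter)
  obtain T where T: "subspace T" "T \<subseteq> B \<inter> C" "dim T = t"
    using subspace_of_dim[OF BC le] .
  have "totally_singular T" using generator_ts_mono[OF gB T(1)] T(2) by blast
  then have "card {B \<in> D. T \<subseteq> B} = 1"
    using T(3) by (rule card_blocks_through)
  then obtain E where E: "{B \<in> D. T \<subseteq> B} = {E}" by (rule card_1_singletonE)
  have "B \<in> {B \<in> D. T \<subseteq> B}" "C \<in> {B \<in> D. T \<subseteq> B}" using B C T(2) by simp_all
  then show False using neq unfolding E by simp
qed

text \<open>The form in which existence of blocks is mostly used: a \<open>(t - 1)\<close>-space and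
  a further point span a \<open>t\<close>-space.\<close>

lemma block_through_point:
  assumes "totally_singular T" "Suc (dim T) = t" "x \<in> perp T" "Q x = 0" "x \<notin> T"
  obtains B where "B \<in> D" "T \<subseteq> B" "x \<in> B"
proof -
  have "dim (span (insert x T)) = t"
    using assms dim_insert_subspace[OF ts_subspace] by simp
  then obtain B where "B \<in> D" "span (insert x T) \<subseteq> B"
    using block_exists ts_span_insert[OF assms(1,4,3)] by blast
  then show ?thesis using that span_superset[of "insert x T"] by blast
qed

lemma blocks_Int_eq:
  assumes "B \<in> D" "C \<in> D" "B \<noteq> C" "subspace T" "Suc (dim T) = t" "T \<subseteq> B" "T \<subseteq> C"
  shows "B \<inter> C = T"
proof (rule subspace_dim_equal[symmetric])
  show "dim (B \<inter> C) \<le> dim T" using dim_block_Int_less[OF assms(1-3)] assms(5) by linarith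
  show "subspace (B \<inter> C)"
    using assms(1,2) by (simp add: block_generator generatorD subspace_inter)
qed (use assms in auto)

text \<open>Three blocks through a common \<open>(t - 1)\<close>-space meet pairwise in that space only; by parity
  this is possible only if its codimension in the blocks is even.\<close>

lemma odd_rank_plus_strength:
  assumes "0 < t" "t < r"
  shows "odd (r + t)"
proof -
  obtain A where A: "A \<in> generators" using generator_exists by blast
  obtain T' where T': "subspace T'" "T' \<subseteq> A" "dim T' = t"
    using subspace_of_dim[OF generatorD(2)[OF A], of t] generatorD(3)[OF A] assms by auto
  then obtain B1 where B1: "B1 \<in> D" "T' \<subseteq> B1"
    using block_exists generator_ts_mono[OF A] by blast
  obtain T where T: "subspace T" "T \<subseteq> T'" "dim T = t - 1"
    using subspace_of_dim[OF T'(1), of "t - 1"] T'(3) by auto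
  have dT: "Suc (dim T) = t" and TB1: "T \<subseteq> B1" using T assms B1 by auto
  note g1 = block_generator[OF B1(1)]
  have tsT: "totally_singular T" using generator_ts_mono[OF g1 T(1) TB1] .
  obtain x where x: "x \<in> perp T" "Q x = 0" "x \<notin> B1"
    using singular_outside[OF g1 T(1) TB1] dT assms by auto
  then obtain B2 where B2: "B2 \<in> D" "T \<subseteq> B2" "x \<in> B2"
    using block_through_point[OF tsT dT x(1,2)] TB1 by blast
  note g2 = block_generator[OF B2(1)]
  have "\<not> B1 \<subseteq> T" using dim_subset[of B1 T] dT assms generatorD(3)[OF g1] by auto
  then obtain b1 where b1: "b1 \<in> B1" "b1 \<notin> T" by blast
  \<comment> \<open>A single linear condition leaves dimension at least \<open>r - 1\<close>, which
    exceeds \<open>dim T = t - 1\<close>.\<close>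
  have "\<not> B2 \<inter> perp {b1} \<subseteq> T"
    using dim_Int_perp_single[OF generatorD(2)[OF g2], of b1] dim_subset[of "B2 \<inter> perp {b1}" T]
      dT assms generatorD(3)[OF g2] by auto
  then obtain b2 where b2: "b2 \<in> B2" "b2 \<notin> T" "polar_form b1 b2 = 0"
    by (auto simp: perp_def)
  have I12: "B1 \<inter> B2 = T"
    using blocks_Int_eq[OF B1(1) B2(1) _ T(1) dT TB1 B2(2)] x B2(3) by blast
  \<comment> \<open>Since \<open>b1\<close> and \<open>b2\<close> are orthogonal, their sum is
    singular; it lies in neither block and so leads to a third one.\<close>
  have "Q (b1 + b2) = 0"
    using b1 b2 ts_Q[OF generatorD(1)[OF g1]] ts_Q[OF generatorD(1)[OF g2]] by (simp add: Q_add)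
  moreover have "b1 + b2 \<in> perp T"
    using b1 b2 generator_subset_perp[OF g1 TB1] generator_subset_perp[OF g2 B2(2)]
    by (intro subspace_add subspace_perp) auto
  moreover have n1: "b1 + b2 \<notin> B1"
    using subspace_diff[OF generatorD(2)[OF g1] _ b1(1), of "b1 + b2"] b2 I12 by auto
  moreover have n2: "b1 + b2 \<notin> B2"
    using subspace_diff[OF generatorD(2)[OF g2] _ b2(1), of "b1 + b2"] b1 I12 by auto
  ultimately obtain B3 where B3: "B3 \<in> D" "T \<subseteq> B3" "b1 + b2 \<in> B3"
    using block_through_point[OF tsT dT, of "b1 + b2"] TB1 by blast
  have "B1 \<inter> B3 = T" "B2 \<inter> B3 = T"
    using blocks_Int_eq[OF B1(1) B3(1) _ T(1) dT TB1 B3(2)]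
      blocks_Int_eq[OF B2(1) B3(1) _ T(1) dT B2(2) B3(2)] n1 n2 B3(3) by blast+
  then have "even (r + dim T + dim T + dim T)"
    using generator_parity[OF g1 g2 block_generator[OF B3(1)]] I12 by simp
  then show ?thesis using dT by auto
qed

text \<open>Any two blocks through \<open>T0\<close> are joined by a third one which shares a \<open>(t - 1)\<close>-space
  with each of them, so they all lie in one of the two classes of generators.\<close>

lemma dim_block_Int_eq:
  assumes B: "B \<in> D" and C: "C \<in> D" and neq: "B \<noteq> C" and "t < r"
    and T0: "subspace T0" "T0 \<subseteq> B" "T0 \<subseteq> C" "Suc (Suc (dim T0)) = t"
  shows "Suc (dim (B \<inter> C)) = t"
proof -
  have odd: "odd (r + t)" using odd_rank_plus_strength assms by simp
  \<comment> \<open>Distinct blocks sharing \<open>T0\<close> and one more vector meet in dimension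
    exactly \<open>t - 1\<close>, which has the parity of \<open>r\<close>.\<close>
  have even_Int: "even (r + dim (X \<inter> Y))"
    if X: "X \<in> D" and Y: "Y \<in> D" and x: "x \<in> X \<inter> Y" "x \<notin> T0" and T0': "T0 \<subseteq> X \<inter> Y" for X Y x
  proof (cases "X = Y")
    case True
    then show ?thesis using generatorD(3)[OF block_generator[OF Y]] by simp
  next
    case False
    let ?T = "span (insert x T0)"
    have "Suc (dim ?T) = t" using dim_insert_subspace[OF T0(1) x(2)] T0(4) by simp
    moreover have "?T \<subseteq> X" "?T \<subseteq> Y"
      using span_insert_le generatorD(2) block_generator X Y x T0' by blast+
    ultimately show ?thesis using blocks_Int_eq[OF X Y False, of ?T] odd by auto
  qed
  note gB = block_generator[OF B] and gC = block_generator[OF C]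
  have "\<not> C \<subseteq> T0" using dim_subset[of C T0] T0(4) \<open>t < r\<close> generatorD(3)[OF gC] by auto
  then obtain y where y: "y \<in> C" "y \<notin> T0" by blast
  \<comment> \<open>A vector \<open>z\<close> of \<open>B\<close> orthogonal to \<open>y\<close> is
    sought, so that some block contains \<open>T0\<close>, \<open>y\<close> and \<open>z\<close> and
    is comparable with both \<open>B\<close> and \<open>C\<close>.\<close>
  have "\<not> B \<inter> perp {y} \<subseteq> T0"
    using dim_Int_perp_single[OF generatorD(2)[OF gB], of y] dim_subset[of "B \<inter> perp {y}" T0]
      T0(4) \<open>t < r\<close> generatorD(3)[OF gB] by auto
  then obtain z where z: "z \<in> B" "z \<notin> T0" "polar_form y z = 0"
    by (auto simp: perp_def)
  let ?U = "span (insert y T0)"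
  have UC: "?U \<subseteq> C" using span_insert_le[OF generatorD(2)[OF gC] T0(3) y(1)] .
  have "even (r + dim (B \<inter> C))"
  proof (cases "z \<in> ?U")
    case True
    then have "z \<in> B \<inter> C" using UC z by blast
    then show ?thesis using even_Int[OF B C _ z(2)] T0 by blast
  next
    case False
    have "z \<in> perp T0" using generator_subset_perp[OF gB T0(2)] z(1) by blast
    then have "z \<in> perp ?U" using z(3) by (subst perp_span) (simp add: perp_def)
    moreover have "totally_singular ?U" using generator_ts_mono[OF gC _ UC] by simp
    moreover have "Suc (dim ?U) = t" using dim_insert_subspace[OF T0(1) y(2)] T0(4) by simp
    ultimately obtain E where E: "E \<in> D" "?U \<subseteq> E" "z \<in> E"
      using block_through_point[of ?U z] False ts_Q[OF generatorD(1)[OF gB] z(1)] by blast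
    then have T0E: "T0 \<subseteq> E" "y \<in> E" using span_superset[of "insert y T0"] by blast+
    have "even (r + dim (B \<inter> E))" using even_Int[OF B E(1) _ z(2)] z E T0 T0E by blast
    moreover have "even (r + dim (E \<inter> C))" using even_Int[OF E(1) C _ y(2)] y T0 T0E by blast
    ultimately show ?thesis
      using generator_parity[OF gB block_generator[OF E(1)] gC] by auto
  qed
  \<comment> \<open>Only \<open>t - 2\<close> and \<open>t - 1\<close> are possible, and
    \<open>t - 2\<close> has the wrong parity.\<close>
  then have "dim (B \<inter> C) \<noteq> dim T0" using odd T0(4) by auto
  moreover have "dim T0 \<le> dim (B \<inter> C)" using T0 by (intro dim_subset) auto
  ultimately show ?thesis using dim_block_Int_less[OF B C neq] T0(4) by linarith
qed

text \<open>For \<open>t + 1 < r\<close> the count of vectors of \<open>G\<close> would give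
  \<open>dim K = t\<close>, although the hyperplane \<open>K\<close> of \<open>G\<close> has
  dimension \<open>r - 1\<close>.\<close>

lemma strength_ge:
  assumes "2 \<le> t"
  shows "r \<le> Suc t"
proof (rule ccontr)
  assume "\<not> r \<le> Suc t"
  then have tr: "Suc t < r" by simp
  let ?q = "card (UNIV :: 'a set)"
  obtain A where A: "A \<in> generators" using generator_exists by blast
  obtain T' where T': "subspace T'" "T' \<subseteq> A" "dim T' = t"
    using subspace_of_dim[OF generatorD(2)[OF A], of t] generatorD(3)[OF A] tr by auto
  then obtain B where B: "B \<in> D" "T' \<subseteq> B"
    using block_exists generator_ts_mono[OF A] by blast
  obtain T0 where T0: "subspace T0" "T0 \<subseteq> T'" "dim T0 = t - 2"
    using subspace_of_dim[OF T'(1), of "t - 2"] T'(3) by auto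
  have dT0: "Suc (Suc (dim T0)) = t" and T0B: "T0 \<subseteq> B" using T0 assms B by auto
  note gB = block_generator[OF B(1)]
  obtain p where p: "p \<in> perp T0" "Q p = 0" "p \<notin> B"
    using singular_outside[OF gB T0(1) T0B] dT0 tr by auto
  define H where "H = neighbour B p"
  note H = neighbour[OF gB p(3,2), folded H_def]
  define T where "T = span (insert p T0)"
  have T: "subspace T" by (simp add: T_def)
  have dT: "Suc (dim T) = t"
    using dim_insert_subspace[OF T0(1), of p] p(3) T0B dT0 by (auto simp: T_def)
  have TH: "T \<subseteq> H"
    unfolding T_def using H(5)[OF T0B p(1)] H(4) by (rule span_insert_le[OF generatorD(2)[OF H(1)]])
  have pT: "p \<in> T" and T0T: "T0 \<subseteq> T" by (auto simp: T_def span_base)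
  obtain x where x: "x \<in> perp T" "Q x = 0" "x \<notin> H"
    using singular_outside[OF H(1) T TH] dT tr by auto
  define G where "G = neighbour H x"
  note G = neighbour[OF H(1) x(3,2), folded G_def]
  have TG: "T \<subseteq> G" using G(5)[OF TH x(1)] .
  let ?K = "H \<inter> G"
  have K: "subspace ?K" using generatorD(2) H(1) G(1) by (simp add: subspace_inter)
  \<comment> \<open>Blocks meeting \<open>G\<close> in \<open>T\<close> alone cover nothing of
    \<open>G - T\<close> and are left out.\<close>
  define \<C> where "\<C> = {C \<in> D. T \<subseteq> C \<and> C \<inter> G \<noteq> T}"
  have dims: "dim (C \<inter> G) = Suc t" "dim (C \<inter> ?K) = t" if "C \<in> \<C>" for C
  proof -
    have C: "C \<in> D" "T \<subseteq> C" "C \<inter> G \<noteq> T" using that by (auto simp: \<C>_def)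
    note gC = block_generator[OF C(1)]
    have sub: "subspace (C \<inter> G)" "subspace (C \<inter> H)"
      using generatorD(2) gC G(1) H(1) by (simp_all add: subspace_inter)
    \<comment> \<open>\<open>C\<close> differs from \<open>B\<close> since it contains
      \<open>p\<close>. As \<open>H\<close> is adjacent to \<open>B\<close>,
      \<open>dim (C \<inter> H)\<close> is \<open>t - 2\<close> or \<open>t\<close>, and
      \<open>T\<close> of dimension \<open>t - 1\<close> excludes the former.\<close>
    have "Suc (dim (B \<inter> C)) = t"
      using dim_block_Int_eq[OF B(1) C(1) _ _ T0(1) T0B _ dT0] C(2) T0T pT p(3) tr by auto
    moreover have "dim T \<le> dim (C \<inter> H)" using C TH by (intro dim_subset) auto
    ultimately have CH: "dim (C \<inter> H) = t"
      using adjacent_dim_Int[OF gB H(1) gC H(3)] dT by (simp add: Int_commute)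
    have "dim (C \<inter> G) \<noteq> dim T"
      using subspace_dim_equal[OF T sub(1)] C TG by auto
    then show CG: "dim (C \<inter> G) = Suc t"
      using adjacent_dim_Int[OF H(1) G(1) gC G(3)] CH dT by (simp add: Int_commute)
    \<comment> \<open>\<open>K\<close> is a hyperplane of \<open>G\<close>, so it cuts at most one
      dimension off \<open>C \<inter> G\<close>; \<open>C \<inter> H\<close> bounds the result from
      above.\<close>
    have "dim (C \<inter> G) \<le> Suc (dim (C \<inter> G \<inter> ?K))"
      using dim_Int_hyperplane[OF generatorD(2)[OF G(1)] sub(1) K] generatorD(3)[OF G(1)] G(3) by simp
    moreover have "C \<inter> G \<inter> ?K = C \<inter> ?K" by blast
    moreover have "dim (C \<inter> ?K) \<le> dim (C \<inter> H)" by (rule dim_subset) blast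
    ultimately show "dim (C \<inter> ?K) = t" using CG CH by simp
  qed
  have cover: "\<exists>C\<in>\<C>. y \<in> C" if y: "y \<in> G" "y \<notin> T" for y
  proof -
    have "y \<in> perp T" using generator_subset_perp[OF G(1) TG] y by blast
    then obtain C where "C \<in> D" "T \<subseteq> C" "y \<in> C"
      using block_through_point[OF generator_ts_mono[OF G(1) T TG] dT, of y] y
        ts_Q[OF generatorD(1)[OF G(1)]] by blast
    then show ?thesis using y by (auto simp: \<C>_def)
  qed
  have disj: "C \<inter> C' = T" if "C \<in> \<C>" "C' \<in> \<C>" "C \<noteq> C'" for C C'
    using blocks_Int_eq[of C C', OF _ _ _ T dT] that by (auto simp: \<C>_def)
  have fin: "finite (UNIV :: 'b set)" using card_subspace(1)[OF subspace_UNIV] .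
  have fC: "finite \<C>" by (rule finite_subset[OF _ finite_Pow_iff[THEN iffD2, OF fin]]) auto
  have fin': "finite S" for S :: "'b set" by (rule finite_subset[OF subset_UNIV fin])
  \<comment> \<open>The blocks of \<open>\<C>\<close> pairwise share only \<open>T\<close>, which
    lies in \<open>K\<close>; hence they partition both \<open>G - K\<close> and
    \<open>K - T\<close>.\<close>
  have "G - ?K \<subseteq> (\<Union>C\<in>\<C>. C \<inter> G - C \<inter> ?K)" using cover TH TG by fastforce
  then have "card (G - ?K) = card (\<Union>C\<in>\<C>. C \<inter> G - C \<inter> ?K)"
    by (intro arg_cong[of _ _ card] equalityI) auto
  also have "\<dots> = (\<Sum>C\<in>\<C>. card (C \<inter> G - C \<inter> ?K))"
    using fC fin' disj TH TG by (intro card_UN_disjoint) blast+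
  also have "\<dots> = (\<Sum>C\<in>\<C>. ?q * card (C \<inter> ?K - T))"
  proof (rule sum.cong[OF refl])
    fix C assume C: "C \<in> \<C>"
    then have "subspace C" "T \<subseteq> C" using generatorD(2) block_generator by (auto simp: \<C>_def)
    then have sub: "subspace (C \<inter> G)" "subspace (C \<inter> ?K)"
      using generatorD(2) G(1) K by (simp_all add: subspace_inter)
    have "card (C \<inter> G - C \<inter> ?K) = ?q ^ Suc t - ?q ^ t"
      using card_Diff_subset[OF fin', of "C \<inter> ?K" "C \<inter> G"] card_subspace(2)[OF sub(1)]
        card_subspace(2)[OF sub(2)] dims[OF C] by fastforce
    \<comment> \<open>The ratio \<open>q\<close> is the same for every block, so it survives
      summation.\<close>
    also have "\<dots> = ?q * (?q ^ t - ?q ^ dim T)"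
      using dT by (auto simp: diff_mult_distrib2)
    also have "\<dots> = ?q * card (C \<inter> ?K - T)"
      using card_Diff_subset[OF fin', of T "C \<inter> ?K"] card_subspace(2)[OF sub(2)]
        card_subspace(2)[OF T] dims[OF C] \<open>T \<subseteq> C\<close> TH TG by simp
    finally show "card (C \<inter> G - C \<inter> ?K) = ?q * card (C \<inter> ?K - T)" .
  qed
  also have "\<dots> = ?q * (\<Sum>C\<in>\<C>. card (C \<inter> ?K - T))" by (simp add: sum_distrib_left)
  also have "(\<Sum>C\<in>\<C>. card (C \<inter> ?K - T)) = card (\<Union>C\<in>\<C>. C \<inter> ?K - T)"
    using fC fin' disj by (intro card_UN_disjoint[symmetric]) blast+
  also have "(\<Union>C\<in>\<C>. C \<inter> ?K - T) = ?K - T" using cover by blast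
  finally have "card (G - ?K) = ?q * card (?K - T)" .
  moreover have "card (G - ?K) = ?q * ?q ^ dim ?K - ?q ^ dim ?K"
    using card_Diff_subset[OF fin', of ?K G] card_subspace(2)[OF generatorD(2)[OF G(1)]]
      card_subspace(2)[OF K] generatorD(3)[OF G(1)] G(3) by (metis inf_le2 power_Suc)
  moreover have "card (?K - T) = ?q ^ dim ?K - ?q ^ dim T"
    using card_Diff_subset[OF fin', of T ?K] card_subspace(2)[OF T] card_subspace(2)[OF K] TH TG
    by simp
  ultimately have eq: "?q * ?q ^ dim ?K - ?q ^ dim ?K = ?q * ?q ^ dim ?K - ?q ^ t"
    using dT by (auto simp: diff_mult_distrib2)
  have "card {0, 1 :: 'a} \<le> ?q" by (rule card_mono) auto
  then have q: "1 < ?q" by simp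
  \<comment> \<open>Subtraction on \<open>nat\<close> truncates; these two bounds permit the
    cancellation in \<open>eq\<close>.\<close>
  have "?q ^ t \<le> ?q ^ dim ?K" using q G(3) tr by (intro power_increasing) auto
  moreover have "?q ^ dim ?K \<le> ?q * ?q ^ dim ?K" using q by simp
  ultimately have "?q ^ dim ?K = ?q ^ t" using eq by linarith
  then have "dim ?K = t" using q by simp
  then show False using G(3) tr by simp
qed

text \<open>The block through \<open>A \<inter> A'\<close> must be one of the adjacent generators
  \<open>A\<close>, \<open>A'\<close>, and both cannot be blocks. Membership in \<open>D\<close>
  thus alternates along adjacency.\<close>

lemma halving_latin_greek:
  assumes "Suc t = r"
  shows "latin_greek_design D"
proof -
  have adj: "A \<in> D \<longleftrightarrow> A' \<notin> D"
    if A: "A \<in> generators" and A': "A' \<in> generators" and d: "Suc (dim (A \<inter> A')) = r" for A A'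
  proof -
    have "totally_singular (A \<inter> A')"
      using generator_ts_mono[OF A, of "A \<inter> A'"] generatorD(2) A A' by (simp add: subspace_inter)
    then obtain B where B: "B \<in> D" "A \<inter> A' \<subseteq> B" using block_exists d assms by auto
    have "B = A \<or> B = A'"
      using generators_through_hyperplane[OF A A' block_generator[OF B(1)] d B(2)] .
    moreover have "A \<noteq> A'" using d generatorD(3)[OF A] by auto
    ultimately show ?thesis using B(1) dim_block_Int_less[of A A'] d assms by auto
  qed
  obtain A where A: "A \<in> generators" using generator_exists by blast
  obtain T where T: "subspace T" "T \<subseteq> A" "dim T = t"
    using subspace_of_dim[OF generatorD(2)[OF A], of t] generatorD(3)[OF A] strength_le by auto
  then obtain C where C: "C \<in> D" using block_exists generator_ts_mono[OF A] by blast
  note gC = block_generator[OF C]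
  \<comment> \<open>Induction on the distance to the fixed block \<open>C\<close>: each step towards
    \<open>C\<close> flips both membership and parity.\<close>
  have "A \<in> D \<longleftrightarrow> even (r - dim (A \<inter> C))" if "A \<in> generators" for A
    using that
  proof (induction "r - dim (A \<inter> C)" arbitrary: A)
    case 0
    then have "A = C"
      using generator_dim_Int_eq[OF 0(2) gC] generator_dim_Int_le[OF 0(2), of C] by simp
    then show ?case using C generatorD(3)[OF gC] by simp
  next
    case (Suc d)
    then have "A \<noteq> C" using generatorD(3)[OF gC] by auto
    then obtain A' where A': "A' \<in> generators" "Suc (dim (A \<inter> A')) = r"
        "dim (A' \<inter> C) = Suc (dim (A \<inter> C))"
      using step_towards[OF Suc.prems gC] by blast
    have d: "d = r - dim (A' \<inter> C)" using Suc(2) A'(3) by linarith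
    have "A' \<in> D \<longleftrightarrow> even d" using Suc.hyps(1)[OF d A'(1)] d by simp
    moreover have "A \<in> D \<longleftrightarrow> A' \<notin> D" using adj[OF Suc.prems A'(1,2)] .
    ultimately show ?case using Suc(2) by (metis even_Suc)
  qed
  then have "D = latin_greek_rel `` {C}"
    using block_generator gC by (auto simp: latin_greek_rel_def Int_commute)
  then show ?thesis using gC by (simp add: latin_greek_design_def quotientI)
qed

text \<open>Each generator is itself a \<open>t\<close>-space, and the block containing it can only
  be that generator.\<close>

lemma full_strength_complete:
  assumes "t = r"
  shows "D = complete_design r"
proof -
  have "A \<in> D" if A: "A \<in> generators" for A
  proof -
    obtain B where B: "B \<in> D" "A \<subseteq> B"
      using block_exists[OF generatorD(1)[OF A]] generatorD(3)[OF A] assms by auto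
    then show ?thesis using generator_eq[OF A block_generator[OF B(1)]] by simp
  qed
  then show ?thesis
    using block_generator by (auto simp: complete_design_def generators_def)
qed

end

end

theorem theorem19:
  fixes scale :: "'a::{field,finite} \<Rightarrow> 'b::ab_group_add \<Rightarrow> 'b"
    and Q :: "'b \<Rightarrow> 'a" and r t :: nat and D :: "'b set set"
  assumes "hyperbolic_polar_space scale Q r"
    and "hyperbolic_polar_space.steiner_system scale Q r t r D"
    and "t \<ge> 2"
  shows "D = hyperbolic_polar_space.complete_design scale Q r
       \<or> hyperbolic_polar_space.latin_greek_design scale Q r D"
proof -
  interpret hyperbolic_polar_space scale Q r by (rule assms(1))
  note D = assms(2)
  have "r = t \<or> r = Suc t"
    using strength_ge[OF D assms(3)] strength_le[OF D] by linarith
  then show ?thesis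
    using full_strength_complete[OF D] halving_latin_greek[OF D] by auto
qed

end
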